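(* Fix $0<\tau<1$ and $\lambda>0$. Let $y_i=\theta^*_i+\epsilon_i$, $1\le i\le n$, where $\theta^*\in\mathbb{R}^n$ is piecewise constant with $K$ pieces (see context) and $\epsilon_1,\dots,\epsilon_n$ are i.i.d. with CDF $F$ such that $F(0)=\tau$ and there is a constant $L>0$ with $$|F(x)-F(0)|\ge L|x|\qquad\text{for all }x\in[-1,1].$$ Let $\rho(x)=\tau|x|$ for $x\ge0$ and $\rho(x)=(1-\tau)|x|$ for $x<0$, and let $$\hat\theta=\arg\min_{\theta\in\mathbb{R}^n}\ \sum_{i=1}^n\rho(y_i-\theta_i)+\lambda\sum_{i=1}^{n-1}|\theta_i-\theta_{i+1}|.$$ Fix any $i\in\{1,\dots,n\}$ and $\delta\in(0,\tfrac{\log2}{e})$, and put $$B^{\mathrm{quantile}}_{i,\delta}=2\left(\sqrt{\frac{\log\log(2\max(3,d_i))}{\max(3,d_i)}}+\sqrt{\frac{\log\frac1\delta}{d_i}}\right)+\frac{\log\log(2m_{k(i)})+\log\frac1\delta}{\lambda}+\frac{\sqrt{m_{k(i)}\log\frac1\delta}+2\lambda}{m_{k(i)}}.$$ If $B^{\mathrm{quantile}}_{i,\delta}\le L$, then $$\Pr\left(|\hat\theta_i-\theta^*_i|\le\frac{B^{\mathrm{quantile}}_{i,\delta}}{L}\right)\ge1-2\Big(1+\frac{24}{(\log2)^2}\Big)\delta^2.$$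
   Context: $\theta^*$ is piecewise constant with $K$ pieces: there are integers $1=n_1<n_2<\cdots<n_K<n$, with the convention $n_{K+1}=n+1$, such that $\theta^*_{n_k}=\theta^*_{n_k+1}=\cdots=\theta^*_{n_{k+1}-1}$ for each $1\le k\le K$. The length of the $k$-th piece is $m_k=n_{k+1}-n_k$. For $i\in\{1,\dots,n\}$, $k(i)$ is the index of the piece containing $i$, i.e. $n_{k(i)}\le i\le n_{k(i)+1}-1$, and $d_i=\min(i+1-n_{k(i)},\,n_{k(i)+1}-i)$. $\arg\min$ denotes a minimizer; $\log$ is the natural logarithm. *)

theory Defs
  imports "HOL-Probability.Probability"
begin

(* A vector in R^n is a function nat => real of which only the values at 1, ..., n are used. *)

(* ns k is the first index of the k-th piece, for k = 1, ..., K; ns (K + 1) = n + 1 is a sentinel.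
   Values on neighbouring pieces are allowed to coincide. *)
definition piecewise_constant ::
  "nat \<Rightarrow> nat \<Rightarrow> (nat \<Rightarrow> nat) \<Rightarrow> (nat \<Rightarrow> real) \<Rightarrow> bool" where
  "piecewise_constant n K ns \<theta> \<longleftrightarrow>
     1 \<le> K \<and> ns 1 = 1 \<and> (\<forall>k\<in>{1..<K}. ns k < ns (k + 1)) \<and> ns K < n \<and> ns (K + 1) = n + 1 \<and>
     (\<forall>k\<in>{1..K}. \<forall>j\<in>{ns k..ns (k + 1) - 1}. \<theta> j = \<theta> (ns k))"

definition piece_length :: "(nat \<Rightarrow> nat) \<Rightarrow> nat \<Rightarrow> nat" where
  "piece_length ns k = ns (k + 1) - ns k"

definition piece_of :: "nat \<Rightarrow> (nat \<Rightarrow> nat) \<Rightarrow> nat \<Rightarrow> nat" where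
  "piece_of K ns i = (THE k. k \<in> {1..K} \<and> ns k \<le> i \<and> i \<le> ns (k + 1) - 1)"

definition boundary_dist :: "nat \<Rightarrow> (nat \<Rightarrow> nat) \<Rightarrow> nat \<Rightarrow> nat" where
  "boundary_dist K ns i =
     min (i + 1 - ns (piece_of K ns i)) (ns (piece_of K ns i + 1) - i)"

definition quantile_loss :: "real \<Rightarrow> real \<Rightarrow> real" where
  "quantile_loss \<tau> x = (if x \<ge> 0 then \<tau> * \<bar>x\<bar> else (1 - \<tau>) * \<bar>x\<bar>)"

definition quantile_tv_objective ::
  "real \<Rightarrow> real \<Rightarrow> nat \<Rightarrow> (nat \<Rightarrow> real) \<Rightarrow> (nat \<Rightarrow> real) \<Rightarrow> real" where
  "quantile_tv_objective \<tau> lam n y \<theta> =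
     (\<Sum>i=1..n. quantile_loss \<tau> (y i - \<theta> i)) + lam * (\<Sum>i=1..n-1. \<bar>\<theta> i - \<theta> (i + 1)\<bar>)"

(* d is the distance to the boundary of the piece, m the length of the piece. *)
definition B_quantile :: "real \<Rightarrow> nat \<Rightarrow> nat \<Rightarrow> real \<Rightarrow> real" where
  "B_quantile lam d m \<delta> =
     2 * (sqrt (ln (ln (2 * real (max 3 d))) / real (max 3 d)) + sqrt (ln (1 / \<delta>) / real d))
     + (ln (ln (2 * real m)) + ln (1 / \<delta>)) / lam
     + (sqrt (real m * ln (1 / \<delta>)) + 2 * lam) / real m"

end

theory Submission
  imports Defs
begin

text \<open>
  Let \<open>{a..b}\<close> be the piece that contains \<open>i\<close> and put \<open>t = B / L\<close>, so that \<open>t \<le> 1\<close>. Suppose that the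
  estimate at \<open>i\<close> exceeds the truth by more than \<open>t\<close>, and let \<open>{l..r}\<close> be the maximal interval around
  \<open>i\<close> inside the piece on which it does so. Lowering the estimate slightly on \<open>{l..r}\<close> does not improve
  the objective. As every \<open>j\<close> in the interval with noise at most \<open>t\<close> has its observation below the
  estimate, optimality bounds the number of such \<open>j\<close> from above by \<open>\<tau>\<close> times the length, plus
  \<open>lam\<close> for each end of the interval that is an end of the piece, minus \<open>lam\<close> for each other end
  (\<open>minimizer_excursion\<close>).

  The expected number of such \<open>j\<close> is at least \<open>\<tau> + L * t = \<tau> + B\<close> times the length. Hence the count
  falls short of its mean by at least \<open>B\<close> times the length, up to the multiples of \<open>lam\<close>. The
  probability that this happens for any interval around \<open>i\<close> is small (\<open>excursion_probability\<close>): the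
  intervals are covered by a few random walks that start at an end of the piece or at \<open>i\<close>, and the
  time-uniform inequality \<open>maximal_inequality_bounded_sums\<close> bounds the probability that such a walk
  ever crosses a line. The slope \<open>B\<close> is the same for all lengths, so that one line
  per kind of interval suffices, and no union over lengths is taken. The summands of \<open>B\<close> make each of the five
  probabilities at most \<open>\<delta>\<^sup>2\<close> (\<open>B_quantile_lower_bounds\<close>).

  Estimates that are too small reduce to the same situation by reflection (\<open>is_arg_min_reflect\<close>), so
  the total failure probability is at most \<open>10 * \<delta>\<^sup>2\<close>, which is below the claimed bound.
\<close>

section \<open>Optimality of the estimate on runs above a level\<close>

text \<open>
  An upper bound on the rate at which the absolute value of the jump at an endpoint \<open>x\<close> of a run
  grows when the run is lowered. If the run stops inside its piece, it stops because the next value is lower, so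
  lowering the run shrinks the jump; at the end \<open>e\<close> of the piece nothing is known about the next
  value and the jump can grow.
\<close>

definition end_slope :: "nat \<Rightarrow> nat \<Rightarrow> real" where
  "end_slope x e = (if x = e then 1 else -1)"

lemma maximal_run:
  fixes a i b :: nat
  assumes "a \<le> i" "i \<le> b" "P i"
  obtains l r where "a \<le> l" "l \<le> i" "i \<le> r" "r \<le> b" "\<And>j. j \<in> {l..r} \<Longrightarrow> P j"
    "l = a \<or> \<not> P (l - 1)" "r = b \<or> \<not> P (r + 1)"
proof -
  have "\<exists>l. a \<le> l \<and> l \<le> i \<and> (\<forall>j\<in>{l..i}. P j) \<and> (l = a \<or> \<not> P (l - 1))"
    using assms(1)
  proof (induction "i - a" arbitrary: a)
    case 0
    thus ?case using assms(3) by (intro exI[of _ i]) auto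
  next
    case (Suc k)
    hence eqs: "k = i - Suc a" "Suc a \<le> i" by auto
    obtain l where l: "Suc a \<le> l" "l \<le> i" "\<forall>j\<in>{l..i}. P j" "l = Suc a \<or> \<not> P (l - 1)"
      using Suc.hyps(1)[of "Suc a", OF eqs] by blast
    show ?case
    proof (cases "l = Suc a \<and> P a")
      case True
      hence "\<forall>j\<in>{a..i}. P j" using l by (auto simp: atLeastAtMost_insertL[symmetric] Suc.prems)
      thus ?thesis using Suc.prems by auto
    next
      case False
      show ?thesis by (rule exI[of _ l]) (use l False in auto)
    qed
  qed
  moreover have "\<exists>r. i \<le> r \<and> r \<le> b \<and> (\<forall>j\<in>{i..r}. P j) \<and> (r = b \<or> \<not> P (r + 1))"
    using assms(2)
  proof (induction "b - i" arbitrary: b)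
    case 0
    thus ?case using assms(3) by (intro exI[of _ i]) auto
  next
    case (Suc k)
    then obtain c where c: "b = Suc c" by (cases b) auto
    hence eqs: "k = c - i" "i \<le> c" using Suc.hyps(2) by auto
    obtain r where r: "i \<le> r" "r \<le> c" "\<forall>j\<in>{i..r}. P j" "r = c \<or> \<not> P (r + 1)"
      using Suc.hyps(1)[of c, OF eqs] by blast
    show ?case
    proof (cases "r = c \<and> P b")
      case True
      hence "\<forall>j\<in>{i..b}. P j" using r c by (auto simp: le_Suc_eq)
      thus ?thesis using Suc.prems by auto
    qed (use r c in auto)
  qed
  ultimately obtain l r where "a \<le> l" "l \<le> i" "\<forall>j\<in>{l..i}. P j" "l = a \<or> \<not> P (l - 1)"
      "i \<le> r" "r \<le> b" "\<forall>j\<in>{i..r}. P j" "r = b \<or> \<not> P (r + 1)" by blast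
  moreover from this have "P j" if "j \<in> {l..r}" for j
    using that by (cases "j \<le> i") auto
  ultimately show thesis by (intro that[of l r])
qed

text \<open>
  The estimate \<open>\<theta>\<close> exceeds \<open>v\<close> on a maximal run around \<open>i\<close>. Lowering it by a small \<open>s\<close> on that run
  cannot decrease the objective. The loss changes at rate \<open>\<tau> - 1\<close> where the observation lies
  below \<open>\<theta>\<close> and at rate \<open>\<tau>\<close> elsewhere, and the penalty changes at most at rate \<open>end_slope\<close> at each
  end. Both rates together are nonnegative, so there cannot be too many observations below \<open>\<theta>\<close> on the run.
\<close>

lemma minimizer_excursion:
  assumes min: "is_arg_min (quantile_tv_objective \<tau> lam n y) (\<lambda>_. True) \<theta>"
    and lam: "0 \<le> lam" and ab: "1 \<le> a" "b \<le> n" and i: "a \<le> i" "i \<le> b" and v: "v < \<theta> i"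
  obtains l r where "a \<le> l" "l \<le> i" "i \<le> r" "r \<le> b" "\<And>j. j \<in> {l..r} \<Longrightarrow> v < \<theta> j"
    "(\<Sum>j=l..r. of_bool (y j < \<theta> j) - \<tau>) \<le> lam * (end_slope l a + end_slope r b)"
proof -
  obtain l r where lr: "a \<le> l" "l \<le> i" "i \<le> r" "r \<le> b" and above: "\<And>j. j \<in> {l..r} \<Longrightarrow> v < \<theta> j"
    and lend: "l = a \<or> \<not> v < \<theta> (l - 1)" and rend: "r = b \<or> \<not> v < \<theta> (r + 1)"
    using maximal_run[OF i, of "\<lambda>j. v < \<theta> j"] v by metis
  \<comment> \<open>The step is so small that it crosses no observation and reverses no jump at the ends, so that
    every change is exactly linear in \<open>s\<close> and no limit is needed.\<close>
  define S where "S = {x \<in> (\<lambda>j. \<theta> j - y j) ` {l..r} \<union> {\<theta> l - \<theta> (l - 1), \<theta> r - \<theta> (r + 1)}. 0 < x}"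
  define s where "s = Min (insert 1 S)"
  have fin: "finite S" unfolding S_def by simp
  have s0: "0 < s" using fin by (auto simp: s_def S_def)
  have "s \<le> x" if "x \<in> S" for x using fin that by (simp add: s_def)
  hence s1: "\<And>j. j \<in> {l..r} \<Longrightarrow> y j < \<theta> j \<Longrightarrow> s \<le> \<theta> j - y j"
    and s2: "\<theta> (l - 1) < \<theta> l \<Longrightarrow> s \<le> \<theta> l - \<theta> (l - 1)"
    and s3: "\<theta> (r + 1) < \<theta> r \<Longrightarrow> s \<le> \<theta> r - \<theta> (r + 1)"
    by (auto simp: S_def)
  have left: "s \<le> \<theta> l - \<theta> (l - 1)" if "l \<noteq> a"
    using that lend above[of l] lr by (intro s2) auto
  have right: "s \<le> \<theta> r - \<theta> (r + 1)" if "r \<noteq> b"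
    using that rend above[of r] lr by (intro s3) auto
  define \<theta>' where "\<theta>' = (\<lambda>j. if j \<in> {l..r} then \<theta> j - s else \<theta> j)"
  have "quantile_tv_objective \<tau> lam n y \<theta> \<le> quantile_tv_objective \<tau> lam n y \<theta>'"
    using min by (simp add: is_arg_min_linorder)
  hence "0 \<le> (\<Sum>j=1..n. quantile_loss \<tau> (y j - \<theta>' j) - quantile_loss \<tau> (y j - \<theta> j))
      + lam * (\<Sum>k=1..n-1. \<bar>\<theta>' k - \<theta>' (k + 1)\<bar> - \<bar>\<theta> k - \<theta> (k + 1)\<bar>)"
    by (simp add: quantile_tv_objective_def sum_subtractf algebra_simps)
  also have "(\<Sum>j=1..n. quantile_loss \<tau> (y j - \<theta>' j) - quantile_loss \<tau> (y j - \<theta> j))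
      = (\<Sum>j=l..r. quantile_loss \<tau> (y j - \<theta>' j) - quantile_loss \<tau> (y j - \<theta> j))"
    using lr ab by (intro sum.mono_neutral_right) (auto simp: \<theta>'_def)
  also have "\<dots> = (\<Sum>j=l..r. s * (\<tau> - of_bool (y j < \<theta> j)))"
  proof (rule sum.cong)
    fix j assume j: "j \<in> {l..r}"
    show "quantile_loss \<tau> (y j - \<theta>' j) - quantile_loss \<tau> (y j - \<theta> j) = s * (\<tau> - of_bool (y j < \<theta> j))"
    proof (cases "y j < \<theta> j")
      case True
      have neg: "quantile_loss \<tau> x = (\<tau> - 1) * x" if "x \<le> 0" for x
        using that by (cases "x = 0") (auto simp: quantile_loss_def algebra_simps)
      from True s1[OF j] have "y j - \<theta>' j \<le> 0" "y j - \<theta> j \<le> 0"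
        using j by (simp_all add: \<theta>'_def)
      thus ?thesis using True j by (simp add: neg) (simp add: \<theta>'_def algebra_simps)
    next
      case False
      thus ?thesis using j s0 by (auto simp: quantile_loss_def \<theta>'_def algebra_simps)
    qed
  qed simp
  also have "\<dots> = - s * (\<Sum>j=l..r. of_bool (y j < \<theta> j) - \<tau>)"
    unfolding sum_distrib_left by (rule sum.cong) (auto simp: algebra_simps)
  also have "lam * (\<Sum>k=1..n-1. \<bar>\<theta>' k - \<theta>' (k + 1)\<bar> - \<bar>\<theta> k - \<theta> (k + 1)\<bar>)
      \<le> lam * (s * end_slope l a + s * end_slope r b)"
  proof (rule mult_left_mono[OF _ lam])
    have "(\<Sum>k=1..n-1. \<bar>\<theta>' k - \<theta>' (k + 1)\<bar> - \<bar>\<theta> k - \<theta> (k + 1)\<bar>) \<le>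
      (\<Sum>k=1..n-1. (if k = l - 1 then s * end_slope l a else 0) + (if k = r then s * end_slope r b else 0))"
    proof (rule sum_mono)
      fix k assume k: "k \<in> {1..n-1}"
      consider "k = l - 1" | "k = r" | "k \<noteq> l - 1" "k \<noteq> r" by blast
      thus "\<bar>\<theta>' k - \<theta>' (k + 1)\<bar> - \<bar>\<theta> k - \<theta> (k + 1)\<bar> \<le>
        (if k = l - 1 then s * end_slope l a else 0) + (if k = r then s * end_slope r b else 0)"
      proof cases
        case 1
        hence "k + 1 = l" "k \<notin> {l..r}" "l \<in> {l..r}" "k \<noteq> r" using k lr by auto
        thus ?thesis using 1 s0 left by (auto simp: \<theta>'_def end_slope_def)
      next
        case 2
        hence "k \<noteq> l - 1" using k lr by auto
        thus ?thesis using 2 s0 right lr by (auto simp: \<theta>'_def end_slope_def)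
      next
        case 3
        hence "k \<in> {l..r} \<longleftrightarrow> k + 1 \<in> {l..r}" using k lr by auto
        thus ?thesis using 3 by (auto simp: \<theta>'_def)
      qed
    qed
    also have "\<dots> = (if l - 1 \<in> {1..n-1} then s * end_slope l a else 0)
        + (if r \<in> {1..n-1} then s * end_slope r b else 0)"
      by (simp add: sum.distrib)
    also have "\<dots> \<le> s * end_slope l a + s * end_slope r b"
      \<comment> \<open>There is no jump before \<open>l = 1\<close> or after \<open>r = n\<close>, but then \<open>l = a\<close> or \<open>r = b\<close>, where the
        slope is \<open>1\<close> and the bound only gets weaker.\<close>
      using s0 lr ab i by (intro add_mono) (auto simp: end_slope_def)
    finally show "(\<Sum>k=1..n-1. \<bar>\<theta>' k - \<theta>' (k + 1)\<bar> - \<bar>\<theta> k - \<theta> (k + 1)\<bar>)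
      \<le> s * end_slope l a + s * end_slope r b" .
  qed
  finally have "0 \<le> s * (lam * (end_slope l a + end_slope r b) - (\<Sum>j=l..r. of_bool (y j < \<theta> j) - \<tau>))"
    by (simp add: algebra_simps)
  hence "(\<Sum>j=l..r. of_bool (y j < \<theta> j) - \<tau>) \<le> lam * (end_slope l a + end_slope r b)"
    using s0 by (simp add: zero_le_mult_iff)
  thus thesis using that lr above by blast
qed

text \<open>
  Reflecting the data exchanges \<open>\<tau>\<close> with \<open>1 - \<tau>\<close>; runs below a level thus become runs above one.
\<close>

lemma is_arg_min_reflect:
  assumes "is_arg_min (quantile_tv_objective \<tau> lam n y) (\<lambda>_. True) \<theta>"
  shows "is_arg_min (quantile_tv_objective (1 - \<tau>) lam n (\<lambda>j. - y j)) (\<lambda>_. True) (\<lambda>j. - \<theta> j)"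
proof -
  have loss: "quantile_loss (1 - \<tau>) (- x) = quantile_loss \<tau> x" for x
    by (auto simp: quantile_loss_def)
  have "quantile_tv_objective (1 - \<tau>) lam n (\<lambda>j. - y j) (\<lambda>j. - \<phi> j) = quantile_tv_objective \<tau> lam n y \<phi>" for \<phi>
  proof -
    have "quantile_loss (1 - \<tau>) (- y j - - \<phi> j) = quantile_loss \<tau> (y j - \<phi> j)" for j
      using loss[of "y j - \<phi> j"] by simp
    moreover have "\<bar>- \<phi> j - - \<phi> (j + 1)\<bar> = \<bar>\<phi> j - \<phi> (j + 1)\<bar>" for j by simp
    ultimately show ?thesis unfolding quantile_tv_objective_def by simp
  qed
  note this[of \<theta>] this[of "\<lambda>j. - \<phi> j" for \<phi>]
  thus ?thesis using assms by (simp add: is_arg_min_linorder)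
qed

section \<open>A maximal inequality for sums of bounded independent variables\<close>

text \<open>
  The running product of the factors \<open>w (\<sigma> 0), w (\<sigma> 1), \<dots>\<close>, frozen as soon as it has reached \<open>c\<close>.
  As a function of the whole family \<open>w\<close> it can be composed with measurable maps on product spaces.
\<close>

fun stopped_product :: "real \<Rightarrow> ('i \<Rightarrow> real) \<Rightarrow> (nat \<Rightarrow> 'i) \<Rightarrow> nat \<Rightarrow> real" where
  "stopped_product c w \<sigma> 0 = 1"
| "stopped_product c w \<sigma> (Suc k) =
     (if c \<le> stopped_product c w \<sigma> k then stopped_product c w \<sigma> k
      else stopped_product c w \<sigma> k * w (\<sigma> k))"

lemma stopped_product_measurable:
  "\<sigma> ` {..<k} \<subseteq> A \<Longrightarrow> (\<lambda>w. stopped_product c w \<sigma> k) \<in> borel_measurable (PiM A (\<lambda>_. borel))"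
proof (induction k)
  case (Suc k)
  have [measurable]: "(\<lambda>w. stopped_product c w \<sigma> k) \<in> borel_measurable (PiM A (\<lambda>_. borel))"
    using Suc by (auto simp: lessThan_Suc)
  have [measurable]: "(\<lambda>w. w (\<sigma> k)) \<in> borel_measurable (PiM A (\<lambda>_. borel))"
    using Suc.prems by (intro measurable_component_singleton) auto
  show ?case by simp
qed simp

lemma stopped_product_cong:
  "(\<And>j. j < k \<Longrightarrow> w (\<sigma> j) = w' (\<sigma> j)) \<Longrightarrow> stopped_product c w \<sigma> k = stopped_product c w' \<sigma> k"
  by (induction k) auto

lemma stopped_product_nonneg:
  "(\<And>j. j < k \<Longrightarrow> 0 \<le> w (\<sigma> j)) \<Longrightarrow> 0 \<le> stopped_product c w \<sigma> k"
  by (induction k) auto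

lemma stopped_product_stays:
  assumes "k \<le> N" "c \<le> stopped_product c w \<sigma> k"
  shows "stopped_product c w \<sigma> N = stopped_product c w \<sigma> k"
  using assms by (induction N) (auto simp: le_Suc_eq)

lemma stopped_product_ge:
  assumes "k \<le> N" "c \<le> (\<Prod>j<k. w (\<sigma> j))"
  shows "c \<le> stopped_product c w \<sigma> N"
proof -
  have agree: "stopped_product c w \<sigma> l = (\<Prod>j<l. w (\<sigma> j)) \<or> c \<le> stopped_product c w \<sigma> l" for l
    by (induction l) (auto simp: lessThan_Suc mult.commute)
  have "c \<le> stopped_product c w \<sigma> k"
    using agree[of k] assms(2) by auto
  thus ?thesis using stopped_product_stays[OF assms(1)] by metis
qed

text \<open>
  Multiplying by an independent factor of mean at most 1 does not increase the expectation, and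
  whether that factor is applied is decided by the earlier factors alone.
\<close>

lemma (in prob_space) stopped_product_expectation:
  fixes W :: "'i \<Rightarrow> 'a \<Rightarrow> real" and \<sigma> :: "nat \<Rightarrow> 'i"
  assumes ind: "indep_vars (\<lambda>_. borel) W I"
    and int: "\<And>j. j \<in> I \<Longrightarrow> integrable M (W j)"
    and nonneg: "\<And>j \<omega>. j \<in> I \<Longrightarrow> \<omega> \<in> space M \<Longrightarrow> 0 \<le> W j \<omega>"
    and mean: "\<And>j. j \<in> I \<Longrightarrow> expectation (W j) \<le> 1"
    and inj: "inj_on \<sigma> {..<k}" and sub: "\<sigma> ` {..<k} \<subseteq> I"
  shows "integrable M (\<lambda>\<omega>. stopped_product c (\<lambda>j. W j \<omega>) \<sigma> k) \<and>
         expectation (\<lambda>\<omega>. stopped_product c (\<lambda>j. W j \<omega>) \<sigma> k) \<le> 1"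
  using inj sub
proof (induction k)
  case 0
  show ?case by (simp add: prob_space)
next
  case (Suc k)
  define Y where "Y = (\<lambda>\<omega>. stopped_product c (\<lambda>j. W j \<omega>) \<sigma> k)"
  define A where "A = (\<lambda>\<omega>. if c \<le> Y \<omega> then Y \<omega> else 0)"
  define G where "G = (\<lambda>\<omega>. if c \<le> Y \<omega> then 0 else Y \<omega>)"
  have intY: "integrable M Y" and EY: "expectation Y \<le> 1"
    using Suc by (auto simp: Y_def lessThan_Suc)
  have [measurable]: "Y \<in> borel_measurable M" using intY by simp
  have intA: "integrable M A" and intG: "integrable M G"
    unfolding A_def G_def by (rule Bochner_Integration.integrable_bound[OF intY]; simp)+
  have kI: "\<sigma> k \<in> I" using Suc.prems by auto
  have notin: "\<sigma> k \<notin> \<sigma> ` {..<k}"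
    using Suc.prems(1) by (auto dest!: inj_onD)
  \<comment> \<open>The value so far depends only on the first factors, hence is independent of the next one.\<close>
  let ?g = "\<lambda>w. if c \<le> stopped_product c w \<sigma> k then 0 else stopped_product c w \<sigma> k"
  have [measurable]: "(\<lambda>w. stopped_product c w \<sigma> k) \<in> borel_measurable (PiM (\<sigma> ` {..<k}) (\<lambda>_. borel))"
    by (rule stopped_product_measurable) simp
  have "indep_var borel (?g \<circ> (\<lambda>\<omega>. restrict (\<lambda>j. W j \<omega>) (\<sigma> ` {..<k})))
          borel ((\<lambda>w. w (\<sigma> k)) \<circ> (\<lambda>\<omega>. restrict (\<lambda>j. W j \<omega>) {\<sigma> k}))"
    by (rule indep_var_compose[OF indep_var_restrict[OF ind]])
      (use kI notin Suc.prems in \<open>auto\<close>)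
  also have "?g \<circ> (\<lambda>\<omega>. restrict (\<lambda>j. W j \<omega>) (\<sigma> ` {..<k})) = G"
  proof
    fix \<omega>
    have "stopped_product c (restrict (\<lambda>j. W j \<omega>) (\<sigma> ` {..<k})) \<sigma> k = Y \<omega>"
      unfolding Y_def by (rule stopped_product_cong) simp
    thus "(?g \<circ> (\<lambda>\<omega>. restrict (\<lambda>j. W j \<omega>) (\<sigma> ` {..<k}))) \<omega> = G \<omega>"
      by (simp add: G_def)
  qed
  also have "(\<lambda>w. w (\<sigma> k)) \<circ> (\<lambda>\<omega>. restrict (\<lambda>j. W j \<omega>) {\<sigma> k}) = W (\<sigma> k)"
    by (simp add: fun_eq_iff)
  finally have indep: "indep_var borel G borel (W (\<sigma> k))" .
  have step: "(\<lambda>\<omega>. stopped_product c (\<lambda>j. W j \<omega>) \<sigma> (Suc k)) = (\<lambda>\<omega>. A \<omega> + G \<omega> * W (\<sigma> k) \<omega>)"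
    by (auto simp: A_def G_def Y_def)
  have intGW: "integrable M (\<lambda>\<omega>. G \<omega> * W (\<sigma> k) \<omega>)"
    by (rule indep_var_integrable[OF indep intG int[OF kI]])
  have "expectation (\<lambda>\<omega>. A \<omega> + G \<omega> * W (\<sigma> k) \<omega>) = expectation A + expectation G * expectation (W (\<sigma> k))"
    using intA intGW by (simp add: indep_var_lebesgue_integral[OF indep intG int[OF kI]])
  also have "\<dots> \<le> expectation A + expectation G * 1"
  proof (intro add_left_mono mult_left_mono mean kI Bochner_Integration.integral_nonneg_AE AE_I2)
    fix \<omega> assume "\<omega> \<in> space M"
    hence "0 \<le> Y \<omega>" unfolding Y_def
      using Suc.prems by (intro stopped_product_nonneg nonneg) auto
    thus "0 \<le> G \<omega>" by (simp add: G_def)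
  qed
  also have "\<dots> = expectation (\<lambda>\<omega>. A \<omega> + G \<omega>)" using intA intG by simp
  also have "(\<lambda>\<omega>. A \<omega> + G \<omega>) = Y" by (auto simp: A_def G_def)
  finally show ?case using EY intA intGW by (auto simp only: step intro: order_trans Bochner_Integration.integrable_add)
qed

text \<open>
  Ville's maximal inequality: once some partial product reaches \<open>c\<close>, the stopped product stays at or
  above \<open>c\<close>, so Markov's inequality for its final value controls all partial products at once.
\<close>

lemma (in prob_space) maximal_inequality_products:
  fixes W :: "'i \<Rightarrow> 'a \<Rightarrow> real" and \<sigma> :: "nat \<Rightarrow> 'i"
  assumes ind: "indep_vars (\<lambda>_. borel) W I"
    and int: "\<And>j. j \<in> I \<Longrightarrow> integrable M (W j)"
    and nonneg: "\<And>j \<omega>. j \<in> I \<Longrightarrow> \<omega> \<in> space M \<Longrightarrow> 0 \<le> W j \<omega>"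
    and mean: "\<And>j. j \<in> I \<Longrightarrow> expectation (W j) \<le> 1"
    and inj: "inj_on \<sigma> {..<N}" and sub: "\<sigma> ` {..<N} \<subseteq> I" and c: "0 < c"
  shows "prob {\<omega> \<in> space M. \<exists>k\<le>N. c \<le> (\<Prod>j<k. W (\<sigma> j) \<omega>)} \<le> 1 / c"
proof -
  define Y where "Y = (\<lambda>\<omega>. stopped_product c (\<lambda>j. W j \<omega>) \<sigma> N)"
  have Y: "integrable M Y" "expectation Y \<le> 1"
    using stopped_product_expectation[OF ind int nonneg mean inj sub] by (auto simp: Y_def)
  have [measurable]: "Y \<in> borel_measurable M" using Y by simp
  have Y0: "0 \<le> Y \<omega>" if "\<omega> \<in> space M" for \<omega>
    unfolding Y_def using sub that by (intro stopped_product_nonneg nonneg) auto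
  have ev: "{\<omega> \<in> space M. c \<le> Y \<omega>} \<in> events" by measurable
  have "prob {\<omega> \<in> space M. \<exists>k\<le>N. c \<le> (\<Prod>j<k. W (\<sigma> j) \<omega>)} \<le> prob {\<omega> \<in> space M. c \<le> Y \<omega>}"
    by (intro finite_measure_mono ev) (auto simp: Y_def intro: stopped_product_ge)
  also have "\<dots> \<le> expectation Y / c"
    by (rule integral_Markov_inequality_measure[where A="{}"]) (use Y Y0 c in auto)
  also have "\<dots> \<le> 1 / c" using Y c by (simp add: divide_right_mono)
  finally show ?thesis .
qed

text \<open>
  By Hoeffding's lemma the factors \<open>exp (u * X j - u\<^sup>2 / 8)\<close> have mean at most 1. This gives the
  probability that the partial sums ever reach a line of slope \<open>u / 8\<close> and intercept \<open>h / u\<close>.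
\<close>

lemma (in prob_space) maximal_inequality_bounded_sums:
  fixes X :: "'i \<Rightarrow> 'a \<Rightarrow> real" and \<sigma> :: "nat \<Rightarrow> 'i"
  assumes ind: "indep_vars (\<lambda>_. borel) X I"
    and range: "\<And>j \<omega>. j \<in> I \<Longrightarrow> \<omega> \<in> space M \<Longrightarrow> X j \<omega> \<in> {p..p + 1}"
    and mean: "\<And>j. j \<in> I \<Longrightarrow> expectation (X j) = 0"
    and inj: "inj_on \<sigma> {..<N}" and sub: "\<sigma> ` {..<N} \<subseteq> I" and u: "0 < u"
  shows "prob {\<omega> \<in> space M. \<exists>k\<le>N. h \<le> u * (\<Sum>j<k. X (\<sigma> j) \<omega>) - real k * u\<^sup>2 / 8} \<le> exp (- h)"
proof -
  define W where "W = (\<lambda>j \<omega>. exp (u * X j \<omega> - u\<^sup>2 / 8))"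
  have meas: "X j \<in> borel_measurable M" if "j \<in> I" for j
    using ind that by (auto simp: indep_vars_def)
  have int: "integrable M (W j)" and EW: "expectation (W j) \<le> 1" if j: "j \<in> I" for j
  proof -
    interpret interval_bounded_random_variable M "X j" p "p + 1"
      by unfold_locales (use range[OF j] meas[OF j] in auto)
    note meas[OF j, measurable]
    have mW: "W j \<in> borel_measurable M" unfolding W_def by measurable
    have "nn_integral M (\<lambda>\<omega>. W j \<omega>) = nn_integral M (\<lambda>\<omega>. ennreal (exp (u * X j \<omega>)) * ennreal (exp (- (u\<^sup>2 / 8))))"
      unfolding W_def by (simp add: ennreal_mult[symmetric] exp_add[symmetric])
    also have "\<dots> = nn_integral M (\<lambda>\<omega>. exp (u * X j \<omega>)) * ennreal (exp (- (u\<^sup>2 / 8)))"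
      by (rule nn_integral_multc) simp
    also have "\<dots> \<le> ennreal (exp (u\<^sup>2 * (p + 1 - p)\<^sup>2 / 8)) * ennreal (exp (- (u\<^sup>2 / 8)))"
      by (intro mult_right_mono Hoeffdings_lemma_nn_integral_0 u mean j) auto
    also have "\<dots> = 1"
      by (simp add: ennreal_mult[symmetric] exp_add[symmetric])
    finally have le1: "nn_integral M (\<lambda>\<omega>. W j \<omega>) \<le> 1" .
    show iW: "integrable M (W j)"
      by (rule integrableI_nonneg[OF mW]) (use le1 in \<open>auto simp: W_def intro: le_less_trans\<close>)
    show "expectation (W j) \<le> 1"
      using le1 iW by (subst (asm) nn_integral_eq_integral) (auto simp: W_def)
  qed
  have indW: "indep_vars (\<lambda>_. borel) W I"
    unfolding W_def by (rule indep_vars_compose2[OF ind]) simp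
  have "(\<Prod>j<k. W (\<sigma> j) \<omega>) = exp (u * (\<Sum>j<k. X (\<sigma> j) \<omega>) - real k * u\<^sup>2 / 8)" for k \<omega>
    unfolding W_def by (simp add: exp_sum[symmetric] sum_subtractf sum_distrib_left)
  hence "prob {\<omega> \<in> space M. \<exists>k\<le>N. h \<le> u * (\<Sum>j<k. X (\<sigma> j) \<omega>) - real k * u\<^sup>2 / 8} =
    prob {\<omega> \<in> space M. \<exists>k\<le>N. exp h \<le> (\<Prod>j<k. W (\<sigma> j) \<omega>)}"
    by simp
  also have "\<dots> \<le> 1 / exp h"
    by (rule maximal_inequality_products[OF indW int _ EW inj sub]) (auto simp: W_def)
  finally show ?thesis by (simp add: exp_minus field_simps)
qed

section \<open>Large sums over intervals around a fixed index\<close>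

lemma sum_shift_up: "(\<Sum>j<k. f (a + j)) = (\<Sum>j=a..<a + k. f j)" for a k :: nat
  by (rule sum.reindex_bij_witness[of _ "\<lambda>j. j - a" "\<lambda>j. a + j"]) auto

lemma sum_shift_down: "k \<le> i + 1 \<Longrightarrow> (\<Sum>j<k. f (i - j)) = (\<Sum>j=i + 1 - k..i. f j)" for i k :: nat
  by (rule sum.reindex_bij_witness[of _ "\<lambda>j. i - j" "\<lambda>j. i - j"]) auto

text \<open>
  Every interval around \<open>i\<close> that carries a large sum comes with one of five line crossings.
  If the interval is the whole piece, a single sum has to be large. If it shares exactly one end
  with the piece, the walk started at that end reaches the line of slope \<open>B\<close> after at least
  \<open>min (i + 1 - a) (b + 1 - i)\<close> steps. If it lies inside the piece, splitting it after \<open>i\<close> shows that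
  one of the two walks that leave \<open>i\<close> to the left and to the right crosses the line of slope \<open>B\<close> and
  intercept \<open>lam\<close>. The conclusion offers a measurable cover of the exceptional set.
\<close>

lemma (in prob_space) excursion_probability:
  fixes X :: "nat \<Rightarrow> 'a \<Rightarrow> real"
  assumes ind: "indep_vars (\<lambda>_. borel) X {a..b}"
    and range: "\<And>j \<omega>. j \<in> {a..b} \<Longrightarrow> \<omega> \<in> space M \<Longrightarrow> X j \<omega> \<in> {p..p + 1}"
    and mean: "\<And>j. j \<in> {a..b} \<Longrightarrow> expectation (X j) = 0"
    and i: "a \<le> i" "i \<le> b" and q: "0 < q" and B: "0 < B"
    and whole: "sqrt (real (b + 1 - a) * q) + 2 * lam \<le> real (b + 1 - a) * B"
    and one_end: "q \<le> real (min (i + 1 - a) (b + 1 - i)) * B\<^sup>2"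
    and interior: "q \<le> 4 * (B * lam)"
  shows "\<exists>A\<in>events. {\<omega> \<in> space M. \<exists>l r. a \<le> l \<and> l \<le> i \<and> i \<le> r \<and> r \<le> b \<and>
           real (r + 1 - l) * B - lam * (end_slope l a + end_slope r b) \<le> (\<Sum>j=l..r. X j \<omega>)} \<subseteq> A \<and>
         prob A \<le> 5 * exp (- 2 * q)" (is "\<exists>A\<in>events. ?E \<subseteq> A \<and> _")
proof -
  have meas: "X j \<in> borel_measurable M" if "j \<in> {a..b}" for j
    using ind that by (auto simp: indep_vars_def)
  define m where "m = b + 1 - a"
  have m: "0 < m" using i by (simp add: m_def)
  define crossing where "crossing = (\<lambda>\<sigma> N u. {\<omega> \<in> space M. \<exists>k\<le>N. 2 * q \<le> u * (\<Sum>j<k. X (\<sigma> j) \<omega>) - real k * u\<^sup>2 / 8})"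
  have bound: "crossing \<sigma> N u \<in> events \<and> prob (crossing \<sigma> N u) \<le> exp (- 2 * q)"
    if "inj_on \<sigma> {..<N}" "\<sigma> ` {..<N} \<subseteq> {a..b}" "0 < u" for \<sigma> N u
  proof
    have "{\<omega> \<in> space M. 2 * q \<le> u * (\<Sum>j<k. X (\<sigma> j) \<omega>) - real k * u\<^sup>2 / 8} \<in> events" if "k \<le> N" for k
    proof -
      have [measurable]: "(\<lambda>\<omega>. \<Sum>j<k. X (\<sigma> j) \<omega>) \<in> borel_measurable M"
        using \<open>\<sigma> ` {..<N} \<subseteq> {a..b}\<close> \<open>k \<le> N\<close>
        by (intro borel_measurable_sum meas) (meson image_subset_iff lessThan_iff order_less_le_trans)
      show ?thesis by measurable
    qed
    hence "(\<Union>k\<in>{..N}. {\<omega> \<in> space M. 2 * q \<le> u * (\<Sum>j<k. X (\<sigma> j) \<omega>) - real k * u\<^sup>2 / 8}) \<in> events"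
      by (intro sets.finite_UN) auto
    also have "(\<Union>k\<in>{..N}. {\<omega> \<in> space M. 2 * q \<le> u * (\<Sum>j<k. X (\<sigma> j) \<omega>) - real k * u\<^sup>2 / 8}) = crossing \<sigma> N u"
      by (auto simp: crossing_def)
    finally show "crossing \<sigma> N u \<in> events" .
    show "prob (crossing \<sigma> N u) \<le> exp (- 2 * q)"
      unfolding crossing_def using maximal_inequality_bounded_sums[OF ind range mean that(1,2,3)] by simp
  qed
  \<comment> \<open>The first three walks use the \<open>u\<close> with the largest exponent: for a sum at least \<open>k * B\<close> the exponent
    \<open>u * k * B - k * u\<^sup>2 / 8\<close> is largest at \<open>u = 4 * B\<close>, and in the first case the same is done for
    the sum \<open>sqrt (m * q)\<close> after \<open>m\<close> steps. With \<open>u = 8 * B\<close> the slope \<open>u / 8\<close> is \<open>B\<close>, so that the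
    exponent no longer depends on the number of steps.\<close>
  define C where "C = (\<lambda>c :: nat.
      if c = 0 then crossing (\<lambda>j. a + j) m (4 * sqrt (real m * q) / real m)
      else if c = 1 then crossing (\<lambda>j. a + j) m (4 * B)
      else if c = 2 then crossing (\<lambda>j. b - j) m (4 * B)
      else if c = 3 then crossing (\<lambda>j. i - j) (i + 1 - a) (8 * B)
      else crossing (\<lambda>j. i + 1 + j) (b - i) (8 * B))"
  have C: "C c \<in> events \<and> prob (C c) \<le> exp (- 2 * q)" for c
  proof -
    have "inj_on (\<lambda>j. a + j) {..<m}" "(\<lambda>j. a + j) ` {..<m} \<subseteq> {a..b}"
      "inj_on (\<lambda>j. b - j) {..<m}" "(\<lambda>j. b - j) ` {..<m} \<subseteq> {a..b}"
      "inj_on (\<lambda>j. i - j) {..<i + 1 - a}" "(\<lambda>j. i - j) ` {..<i + 1 - a} \<subseteq> {a..b}"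
      "inj_on (\<lambda>j. i + 1 + j) {..<b - i}" "(\<lambda>j. i + 1 + j) ` {..<b - i} \<subseteq> {a..b}"
      using i by (auto simp: inj_on_def m_def)
    moreover have "0 < 4 * sqrt (real m * q) / real m" "0 < 4 * B" "0 < 8 * B" using m q B by auto
    ultimately show ?thesis unfolding C_def by (simp only: bound split: if_split) blast
  qed
  have "?E \<subseteq> (\<Union>c\<in>{..<5}. C c)"
  proof safe
    fix \<omega> l r assume \<omega>: "\<omega> \<in> space M" and lr: "a \<le> l" "l \<le> i" "i \<le> r" "r \<le> b"
      and large: "real (r + 1 - l) * B - lam * (end_slope l a + end_slope r b) \<le> (\<Sum>j=l..r. X j \<omega>)"
    consider "l = a" "r = b" | "l = a" "r < b" | "a < l" "r = b" | "a < l" "r < b" using lr by force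
    then obtain c where "c < 5" "\<omega> \<in> C c"
    proof cases
      case 1
      hence "sqrt (real m * q) \<le> (\<Sum>j=a..b. X j \<omega>)"
        using large whole by (simp add: end_slope_def m_def)
      hence "4 * sqrt (real m * q) / real m * sqrt (real m * q) \<le> 4 * sqrt (real m * q) / real m * (\<Sum>j=a..b. X j \<omega>)"
        using m q by (intro mult_left_mono) auto
      moreover have "4 * sqrt (real m * q) / real m * sqrt (real m * q) = 4 * q"
        using m q by (simp add: field_simps)
      moreover have "real m * (4 * sqrt (real m * q) / real m)\<^sup>2 / 8 = 2 * q"
        using m q by (simp add: power_divide power_mult_distrib power2_eq_square)
      moreover have "(\<Sum>j<m. X (a + j) \<omega>) = (\<Sum>j=a..b. X j \<omega>)"
        unfolding sum_shift_up[of "\<lambda>j. X j \<omega>" a m] using i by (intro sum.cong) (auto simp: m_def)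
      ultimately have "\<omega> \<in> C 0" using \<omega> unfolding C_def crossing_def by auto
      thus ?thesis by (rule that[rotated]) simp
    next
      case 2
      define k where "k = r + 1 - a"
      have k: "k \<le> m" "i + 1 - a \<le> k" using lr by (auto simp: k_def m_def)
      have "(\<Sum>j<k. X (a + j) \<omega>) = (\<Sum>j=a..r. X j \<omega>)"
        unfolding sum_shift_up[of "\<lambda>j. X j \<omega>" a k] using lr 2 by (intro sum.cong) (auto simp: k_def)
      hence "real k * B \<le> (\<Sum>j<k. X (a + j) \<omega>)" using large 2 by (simp add: end_slope_def k_def)
      hence "4 * B * (real k * B) \<le> 4 * B * (\<Sum>j<k. X (a + j) \<omega>)" using B by (intro mult_left_mono) auto
      moreover have "q \<le> real k * B\<^sup>2"
        by (rule order_trans[OF one_end]) (use k in \<open>auto intro!: mult_right_mono\<close>)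
      ultimately have "2 * q \<le> 4 * B * (\<Sum>j<k. X (a + j) \<omega>) - real k * (4 * B)\<^sup>2 / 8"
        by (simp add: power2_eq_square algebra_simps)
      hence "\<omega> \<in> C 1" using \<omega> k unfolding C_def crossing_def by auto
      thus ?thesis by (rule that[rotated]) simp
    next
      case 3
      define k where "k = b + 1 - l"
      have k: "k \<le> m" "b + 1 - i \<le> k" using lr by (auto simp: k_def m_def)
      have "(\<Sum>j<k. X (b - j) \<omega>) = (\<Sum>j=l..b. X j \<omega>)"
        using lr 3 by (subst sum_shift_down) (auto simp: k_def)
      hence "real k * B \<le> (\<Sum>j<k. X (b - j) \<omega>)" using large 3 by (simp add: end_slope_def k_def)
      hence "4 * B * (real k * B) \<le> 4 * B * (\<Sum>j<k. X (b - j) \<omega>)" using B by (intro mult_left_mono) auto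
      moreover have "q \<le> real k * B\<^sup>2"
        by (rule order_trans[OF one_end]) (use k in \<open>auto intro!: mult_right_mono\<close>)
      ultimately have "2 * q \<le> 4 * B * (\<Sum>j<k. X (b - j) \<omega>) - real k * (4 * B)\<^sup>2 / 8"
        by (simp add: power2_eq_square algebra_simps)
      hence "\<omega> \<in> C 2" using \<omega> k unfolding C_def crossing_def by auto
      thus ?thesis by (rule that[rotated]) simp
    next
      case 4
      define k1 k2 where "k1 = i + 1 - l" and "k2 = r - i"
      have k: "k1 \<le> i + 1 - a" "k2 \<le> b - i" "r + 1 - l = k1 + k2" using lr by (auto simp: k1_def k2_def)
      have s1: "(\<Sum>j<k1. X (i - j) \<omega>) = (\<Sum>j=l..i. X j \<omega>)"
        using lr 4 by (subst sum_shift_down) (auto simp: k1_def)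
      have s2: "(\<Sum>j<k2. X (i + 1 + j) \<omega>) = (\<Sum>j=i+1..r. X j \<omega>)"
        unfolding sum_shift_up[of "\<lambda>j. X j \<omega>" "i + 1" k2] using lr by (intro sum.cong) (auto simp: k2_def)
      have "(\<Sum>j=l..r. X j \<omega>) = (\<Sum>j=l..i. X j \<omega>) + (\<Sum>j=i+1..r. X j \<omega>)"
        using lr sum.ub_add_nat[of l i "\<lambda>j. X j \<omega>" "r - i"] by simp
      hence "real k1 * B + lam + (real k2 * B + lam) \<le> (\<Sum>j<k1. X (i - j) \<omega>) + (\<Sum>j<k2. X (i + 1 + j) \<omega>)"
        using large 4 unfolding s1 s2 k(3) by (simp add: end_slope_def algebra_simps)
      moreover have cross: "2 * q \<le> 8 * B * S - real k * (8 * B)\<^sup>2 / 8" if "real k * B + lam \<le> S" for k S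
      proof -
        have "8 * B * (real k * B + lam) \<le> 8 * B * S" using B that by (intro mult_left_mono) auto
        thus ?thesis using interior by (simp add: power2_eq_square algebra_simps)
      qed
      ultimately consider "real k1 * B + lam \<le> (\<Sum>j<k1. X (i - j) \<omega>)" | "real k2 * B + lam \<le> (\<Sum>j<k2. X (i + 1 + j) \<omega>)"
        by linarith
      thus ?thesis
      proof cases
        case 1
        hence "\<omega> \<in> C 3" using cross[OF 1] \<omega> k unfolding C_def crossing_def by auto
        thus ?thesis by (rule that[rotated]) simp
      next
        case 2
        hence "\<omega> \<in> C 4" using cross[OF 2] \<omega> k unfolding C_def crossing_def by auto
        thus ?thesis by (rule that[rotated]) simp
      qed
    qed
    thus "\<omega> \<in> (\<Union>c\<in>{..<5}. C c)" by auto
  qed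
  moreover have "prob (\<Union>c\<in>{..<5}. C c) \<le> 5 * exp (- 2 * q)"
  proof -
    have "prob (\<Union>c\<in>{..<5}. C c) \<le> (\<Sum>c<5. prob (C c))"
      using C by (intro finite_measure_subadditive_finite) auto
    also have "\<dots> \<le> (\<Sum>c<(5::nat). exp (- 2 * q))" using C by (intro sum_mono) auto
    finally show ?thesis by simp
  qed
  ultimately show ?thesis using C by (intro bexI[of _ "\<Union>c\<in>{..<5}. C c"]) auto
qed

section \<open>Pieces and the size of the bound\<close>

lemma piece_of_contains:
  assumes pc: "piecewise_constant n K ns \<theta>" and i: "i \<in> {1..n}"
  shows "piece_of K ns i \<in> {1..K}" "ns (piece_of K ns i) \<le> i" "i \<le> ns (piece_of K ns i + 1) - 1"
    "1 \<le> ns (piece_of K ns i)" "ns (piece_of K ns i + 1) \<le> n + 1"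
proof -
  have K: "1 \<le> K" and first: "ns 1 = 1" and last: "ns (K + 1) = n + 1"
    using pc by (auto simp: piecewise_constant_def)
  have increase: "ns k < ns (Suc k)" if "k \<in> {1..K}" for k
    using pc that by (cases "k = K") (auto simp: piecewise_constant_def)
  have mono: "ns j \<le> ns k" if "1 \<le> j" "j \<le> k" "k \<le> K + 1" for j k
    using that(2,3)
  proof (induction k rule: dec_induct)
    case (step k)
    thus ?case using increase[of k] that(1) by auto
  qed simp
  let ?Q = "\<lambda>k. k \<in> {1..K} \<and> ns k \<le> i \<and> i \<le> ns (k + 1) - 1"
  define k where "k = Max {k \<in> {1..K}. ns k \<le> i}"
  have "k \<in> {k \<in> {1..K}. ns k \<le> i}"
    unfolding k_def using K first i by (intro Max_in) auto
  hence k: "k \<in> {1..K}" "ns k \<le> i" by auto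
  have "i < ns (k + 1)"
  proof (rule ccontr)
    assume "\<not> i < ns (k + 1)"
    moreover from this have "k \<noteq> K" using last i by auto
    ultimately have "k + 1 \<in> {k \<in> {1..K}. ns k \<le> i}" using k by auto
    hence "k + 1 \<le> k" unfolding k_def by (intro Max_ge) auto
    thus False by simp
  qed
  hence Qk: "?Q k" using k by auto
  have uniq: "k' = k" if "?Q k'" for k'
  proof (rule ccontr)
    assume "k' \<noteq> k"
    hence "k' + 1 \<le> k \<or> k + 1 \<le> k'" by auto
    hence "ns (k' + 1) \<le> ns k \<or> ns (k + 1) \<le> ns k'" using mono[of "k' + 1" k] mono[of "k + 1" k'] that Qk by auto
    moreover have "i < ns (k' + 1)" using that i by auto
    ultimately show False using that Qk \<open>i < ns (k + 1)\<close> by auto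
  qed
  have "piece_of K ns i = k"
    unfolding piece_of_def by (rule the_equality[where P = ?Q], rule Qk, erule uniq)
  thus "piece_of K ns i \<in> {1..K}" "ns (piece_of K ns i) \<le> i" "i \<le> ns (piece_of K ns i + 1) - 1"
    "1 \<le> ns (piece_of K ns i)" "ns (piece_of K ns i + 1) \<le> n + 1"
    using Qk mono[of 1 k] mono[of "k + 1" "K + 1"] first last by auto
qed

text \<open>
  The kinds of intervals draw on different summands: the whole piece on the last one, the intervals
  that touch one end of the piece on \<open>2 * sqrt (ln (1 / \<delta>) / d)\<close>, and the interior intervals on the
  quotient by \<open>lam\<close>.
  The upper bound on \<open>\<delta>\<close> is what keeps this quotient positive: for \<open>m = 1\<close> the iterated
  logarithm is the negative number \<open>ln (ln 2)\<close>, and \<open>ln (1 / \<delta>)\<close> exceeds \<open>1 - ln (ln 2)\<close>.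
\<close>

lemma B_quantile_lower_bounds:
  assumes d: "1 \<le> d" and m: "1 \<le> m" and lam: "0 < lam" and \<delta>: "\<delta> \<in> {0<..<ln 2 / exp 1}"
  shows "0 < ln (1 / \<delta>)"
    and "0 < B_quantile lam d m \<delta>"
    and "sqrt (real m * ln (1 / \<delta>)) + 2 * lam \<le> real m * B_quantile lam d m \<delta>"
    and "ln (1 / \<delta>) \<le> real d * (B_quantile lam d m \<delta>)\<^sup>2"
    and "ln (1 / \<delta>) \<le> 4 * (B_quantile lam d m \<delta> * lam)"
proof -
  define q where "q = ln (1 / \<delta>)"
  define B where "B = B_quantile lam d m \<delta>"
  define t1 where "t1 = 2 * sqrt (ln (ln (2 * real (max 3 d))) / real (max 3 d))"
  define t2 where "t2 = 2 * sqrt (q / real d)"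
  define t3 where "t3 = (ln (ln (2 * real m)) + q) / lam"
  define t4 where "t4 = (sqrt (real m * q) + 2 * lam) / real m"
  have B: "B = t1 + t2 + t3 + t4"
    by (simp add: B_def B_quantile_def t1_def t2_def t3_def t4_def q_def)
  \<comment> \<open>A crude numerical bound on \<open>ln (ln 2)\<close> suffices to save a quarter of \<open>q\<close>.\<close>
  have ln2: "2 / 3 \<le> ln (2 :: real)" by (rule ln2_ge_two_thirds)
  have "ln (3 / 2 :: real) \<le> 1 / 2" using ln_le_minus_one[of "3 / 2 :: real"] by simp
  moreover have "ln (2 / 3 :: real) = - ln (3 / 2)" by (simp add: ln_div)
  ultimately have "- 1 / 2 \<le> ln (2 / 3 :: real)" by simp
  also have "\<dots> \<le> ln (ln 2)" using ln2 by simp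
  finally have lnln2: "- 1 / 2 \<le> ln (ln (2 :: real))" .
  have "ln \<delta> < ln (ln 2 / exp 1)" using \<delta> by (subst ln_less_cancel_iff) auto
  hence q1: "1 - ln (ln 2) < q" using \<delta> by (simp add: q_def ln_div)
  have "ln (ln (2 :: real)) \<le> 0" using ln_le_minus_one[of "2 :: real"] by simp
  hence q0: "0 < q" using q1 by linarith
  have "ln (ln 2) \<le> ln (ln (2 * real m))" using m by simp
  hence t3_large: "q / 4 \<le> ln (ln (2 * real m)) + q" using lnln2 q1 by linarith
  have "exp 1 \<le> 2 * real (max 3 d)" using exp_le by (auto simp: max_def)
  hence "1 \<le> ln (2 * real (max 3 d))" by (subst ln_ge_iff) auto
  hence "0 \<le> ln (ln (2 * real (max 3 d)))" by simp
  hence t1: "0 \<le> t1" unfolding t1_def by (simp add: zero_le_divide_iff)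
  have t2: "0 \<le> t2" using q0 by (simp add: t2_def)
  have t3: "0 < t3" using t3_large q0 lam by (simp add: t3_def)
  have t4: "0 \<le> t4" using q0 lam by (simp add: t4_def)
  show "0 < ln (1 / \<delta>)" using q0 by (simp add: q_def)
  show "0 < B_quantile lam d m \<delta>" using B t1 t2 t3 t4 by (simp add: B_def)
  have "real m * t4 \<le> real m * B" using B t1 t2 t3 by (intro mult_left_mono) auto
  thus "sqrt (real m * ln (1 / \<delta>)) + 2 * lam \<le> real m * B_quantile lam d m \<delta>"
    using m by (simp add: t4_def B_def q_def)
  have "t2\<^sup>2 \<le> B\<^sup>2" using B t1 t2 t3 t4 by (intro power_mono) auto
  hence "real d * t2\<^sup>2 \<le> real d * B\<^sup>2" by (rule mult_left_mono) simp
  moreover have "real d * t2\<^sup>2 = 4 * q" using d q0 by (simp add: t2_def power_mult_distrib)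
  ultimately show "ln (1 / \<delta>) \<le> real d * (B_quantile lam d m \<delta>)\<^sup>2"
    using q0 by (simp add: B_def q_def)
  have "q / 4 \<le> t3 * lam" using t3_large lam by (simp add: t3_def)
  also have "\<dots> \<le> B * lam" using B t1 t2 t4 lam by (intro mult_right_mono) auto
  finally show "ln (1 / \<delta>) \<le> 4 * (B_quantile lam d m \<delta> * lam)" by (simp add: B_def q_def)
qed

section \<open>The pointwise error bound\<close>

theorem corollary2:
  fixes M :: "'a measure"
    and \<tau> lam L \<delta> :: real
    and n K i :: nat
    and ns :: "nat \<Rightarrow> nat"
    and \<theta>_star :: "nat \<Rightarrow> real"
    and \<epsilon> :: "nat \<Rightarrow> 'a \<Rightarrow> real"
    and F :: "real \<Rightarrow> real"
    and y \<theta>_hat :: "'a \<Rightarrow> nat \<Rightarrow> real"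
    and B :: real
  assumes "prob_space M"
    and "0 < \<tau>" and "\<tau> < 1" and "lam > 0"
    and "piecewise_constant n K ns \<theta>_star"
    and "prob_space.indep_vars M (\<lambda>_. borel) \<epsilon> {1..n}"
    and "\<And>j. j \<in> {1..n} \<Longrightarrow> cdf (distr M borel (\<epsilon> j)) = F"
    and "F 0 = \<tau>"
    and "L > 0"
    and "\<And>x. x \<in> {-1..1} \<Longrightarrow> \<bar>F x - F 0\<bar> \<ge> L * \<bar>x\<bar>"
    and "\<And>\<omega> j. \<omega> \<in> space M \<Longrightarrow> j \<in> {1..n} \<Longrightarrow> y \<omega> j = \<theta>_star j + \<epsilon> j \<omega>"
    and "\<And>\<omega>. \<omega> \<in> space M \<Longrightarrow>
           is_arg_min (quantile_tv_objective \<tau> lam n (y \<omega>)) (\<lambda>_. True) (\<theta>_hat \<omega>)"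
    and "i \<in> {1..n}"
    and "(\<lambda>\<omega>. \<theta>_hat \<omega> i) \<in> borel_measurable M"
    and "\<delta> \<in> {0<..<ln 2 / exp 1}"
    and "B = B_quantile lam (boundary_dist K ns i) (piece_length ns (piece_of K ns i)) \<delta>"
    and "B \<le> L"
  shows "\<P>(\<omega> in M. \<bar>\<theta>_hat \<omega> i - \<theta>_star i\<bar> \<le> B / L)
           \<ge> 1 - 2 * (1 + 24 / (ln 2)\<^sup>2) * \<delta>\<^sup>2"
proof -
  interpret prob_space M by fact
  note \<tau> = assms(2,3) and lam = assms(4) and pc = assms(5) and ind = assms(6) and cdfF = assms(7)
    and F0 = assms(8) and L = assms(9) and growth = assms(10) and y = assms(11) and argmin = assms(12)
    and i = assms(13) and \<delta> = assms(15) and B_eq = assms(16) and BL = assms(17)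
  note [measurable] = assms(14)
  define k where "k = piece_of K ns i"
  define a b where "a = ns k" and "b = ns (k + 1) - 1"
  define m d q t where "m = piece_length ns k" and "d = boundary_dist K ns i"
    and "q = ln (1 / \<delta>)" and "t = B / L"
  note piece = piece_of_contains[OF pc i, folded k_def]
  have ab: "1 \<le> a" "a \<le> i" "i \<le> b" "b \<le> n" using piece by (auto simp: a_def b_def)
  have m: "m = b + 1 - a" and d: "d = min (i + 1 - a) (b + 1 - i)"
    using ab unfolding m_def d_def piece_length_def boundary_dist_def k_def[symmetric] a_def b_def by auto
  have const: "\<theta>_star j = \<theta>_star i" if "j \<in> {a..b}" for j
  proof -
    have "\<forall>k\<in>{1..K}. \<forall>j\<in>{ns k..ns (k + 1) - 1}. \<theta>_star j = \<theta>_star (ns k)"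
      using pc unfolding piecewise_constant_def by blast
    from bspec[OF this piece(1)] have "\<forall>j\<in>{a..b}. \<theta>_star j = \<theta>_star a"
      unfolding a_def b_def .
    moreover have "i \<in> {a..b}" using ab by simp
    ultimately show ?thesis using that by metis
  qed
  have B_eq: "B = B_quantile lam d m \<delta>" using B_eq by (simp add: m_def d_def k_def)
  have dm: "1 \<le> d" "1 \<le> m" using ab by (auto simp: m d)
  note Bq = B_quantile_lower_bounds[OF dm lam \<delta>, folded B_eq q_def]
  have t: "0 < t" "t \<le> 1" "L * t = B" using Bq(2) L BL by (auto simp: t_def)

  have meas [measurable]: "\<epsilon> j \<in> borel_measurable M" if "j \<in> {1..n}" for j
    using ind that by (auto simp: indep_vars_def)
  have F: "F x = prob {\<omega> \<in> space M. \<epsilon> j \<omega> \<le> x}" if "j \<in> {1..n}" for j x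
  proof -
    have "F x = measure (distr M borel (\<epsilon> j)) {..x}" using cdfF[OF that] by (auto simp: cdf_def)
    also have "\<dots> = prob {\<omega> \<in> space M. \<epsilon> j \<omega> \<le> x}"
      using meas[OF that] by (subst measure_distr) (auto intro!: arg_cong[of _ _ prob])
    finally show ?thesis .
  qed
  have mono: "F x \<le> F x'" if "x \<le> x'" for x x'
    unfolding F[OF i] using that meas[OF i] by (intro finite_measure_mono) auto
  have mean: "integrable M (\<lambda>\<omega>. of_bool (\<epsilon> j \<omega> \<le> x) :: real)"
    "expectation (\<lambda>\<omega>. of_bool (\<epsilon> j \<omega> \<le> x)) = F x" if "j \<in> {1..n}" for j x
  proof -
    note meas[OF that, measurable]
    show "integrable M (\<lambda>\<omega>. of_bool (\<epsilon> j \<omega> \<le> x) :: real)"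
      by (rule integrable_const_bound[where B = 1]) auto
    have "expectation (\<lambda>\<omega>. of_bool (\<epsilon> j \<omega> \<le> x)) = expectation (indicator {\<omega> \<in> space M. \<epsilon> j \<omega> \<le> x})"
      by (intro Bochner_Integration.integral_cong) (auto simp: indicator_def)
    also have "\<dots> = prob {\<omega> \<in> space M. \<epsilon> j \<omega> \<le> x}"
      by (subst Bochner_Integration.integral_indicator) (auto intro!: arg_cong[of _ _ prob])
    finally show "expectation (\<lambda>\<omega>. of_bool (\<epsilon> j \<omega> \<le> x)) = F x" using F[OF that] by simp
  qed
  have up: "\<tau> + B \<le> F t" and down: "F (- t) \<le> \<tau> - B"
  proof -
    have "B \<le> \<bar>F t - \<tau>\<bar>" "B \<le> \<bar>F (- t) - \<tau>\<bar>"
      using growth[of t] growth[of "- t"] t F0 by simp_all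
    thus "\<tau> + B \<le> F t" "F (- t) \<le> \<tau> - B"
      using mono[of 0 t] mono[of "- t" 0] t F0 by linarith+
  qed

  \<comment> \<open>The growth condition at \<open>t\<close> and \<open>- t\<close> has turned the level \<open>t = B / L\<close> into the drift \<open>B\<close> per
    observation, which the centred indicators have to make up for.\<close>
  let ?excursion = "\<lambda>X. {\<omega> \<in> space M. \<exists>l r. a \<le> l \<and> l \<le> i \<and> i \<le> r \<and> r \<le> b \<and>
    real (r + 1 - l) * B - lam * (end_slope l a + end_slope r b) \<le> (\<Sum>j=l..r. X j \<omega>)}"
  have ind_ab: "indep_vars (\<lambda>_. borel) \<epsilon> {a..b}" by (rule indep_vars_subset[OF ind]) (use ab in auto)
  define Xu where "Xu = (\<lambda>j \<omega>. F t - of_bool (\<epsilon> j \<omega> \<le> t))"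
  define Xd where "Xd = (\<lambda>j \<omega>. of_bool (\<epsilon> j \<omega> \<le> - t) - F (- t))"
  have "\<exists>A\<in>events. ?excursion Xu \<subseteq> A \<and> prob A \<le> 5 * exp (- 2 * q)"
  proof (rule excursion_probability[where p = "F t - 1"])
    show "indep_vars (\<lambda>_. borel) Xu {a..b}"
      unfolding Xu_def by (rule indep_vars_compose2[OF ind_ab]) measurable
    show "expectation (Xu j) = 0" if "j \<in> {a..b}" for j
      unfolding Xu_def using mean[of j t] that ab by (simp add: prob_space)
  qed (use ab Bq in \<open>auto simp: Xu_def m d\<close>)
  then obtain U where U: "U \<in> events" "?excursion Xu \<subseteq> U" "prob U \<le> 5 * exp (- 2 * q)" by blast
  have "\<exists>A\<in>events. ?excursion Xd \<subseteq> A \<and> prob A \<le> 5 * exp (- 2 * q)"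
  proof (rule excursion_probability[where p = "- F (- t)"])
    show "indep_vars (\<lambda>_. borel) Xd {a..b}"
      unfolding Xd_def by (rule indep_vars_compose2[OF ind_ab]) measurable
    show "expectation (Xd j) = 0" if "j \<in> {a..b}" for j
      unfolding Xd_def using mean[of j "- t"] that ab by (simp add: prob_space)
  qed (use ab Bq in \<open>auto simp: Xd_def m d\<close>)
  then obtain D where D: "D \<in> events" "?excursion Xd \<subseteq> D" "prob D \<le> 5 * exp (- 2 * q)" by blast

  let ?good = "{\<omega> \<in> space M. \<bar>\<theta>_hat \<omega> i - \<theta>_star i\<bar> \<le> B / L}"
  have "\<omega> \<in> U \<union> D" if \<omega>: "\<omega> \<in> space M" and bad: "\<not> \<bar>\<theta>_hat \<omega> i - \<theta>_star i\<bar> \<le> t" for \<omega>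
  proof -
    note am = argmin[OF \<omega>]
    have y: "y \<omega> j = \<theta>_star i + \<epsilon> j \<omega>" if "j \<in> {a..b}" for j
      using y[OF \<omega>, of j] const[OF that] that ab by auto
    from bad consider "\<theta>_star i + t < \<theta>_hat \<omega> i" | "- (\<theta>_star i - t) < - \<theta>_hat \<omega> i" by linarith
    thus ?thesis
    proof cases
      case 1
      from minimizer_excursion[OF am less_imp_le[OF lam] ab(1,4,2,3) 1] obtain l r
        where lr: "a \<le> l" "l \<le> i" "i \<le> r" "r \<le> b"
          and above: "\<And>j. j \<in> {l..r} \<Longrightarrow> \<theta>_star i + t < \<theta>_hat \<omega> j"
          and sum: "(\<Sum>j=l..r. of_bool (y \<omega> j < \<theta>_hat \<omega> j) - \<tau>) \<le> lam * (end_slope l a + end_slope r b)"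
        by blast
      \<comment> \<open>Noise at most \<open>t\<close> puts the observation below the estimate on the run.\<close>
      have "real (r + 1 - l) * B - (\<Sum>j=l..r. of_bool (y \<omega> j < \<theta>_hat \<omega> j) - \<tau>)
          = (\<Sum>j=l..r. B - (of_bool (y \<omega> j < \<theta>_hat \<omega> j) - \<tau>))"
        by (simp add: sum_subtractf)
      also have "\<dots> \<le> (\<Sum>j=l..r. Xu j \<omega>)"
      proof (rule sum_mono)
        fix j assume j: "j \<in> {l..r}"
        hence "y \<omega> j = \<theta>_star i + \<epsilon> j \<omega>" using lr by (intro y) auto
        thus "B - (of_bool (y \<omega> j < \<theta>_hat \<omega> j) - \<tau>) \<le> Xu j \<omega>"
          using above[OF j] up by (auto simp: Xu_def of_bool_def)
      qed
      finally have "real (r + 1 - l) * B - lam * (end_slope l a + end_slope r b) \<le> (\<Sum>j=l..r. Xu j \<omega>)"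
        using sum by linarith
      hence "\<omega> \<in> ?excursion Xu" using \<omega> lr by blast
      thus ?thesis using U by blast
    next
      case 2
      from minimizer_excursion[OF is_arg_min_reflect[OF am] less_imp_le[OF lam] ab(1,4,2,3) 2] obtain l r
        where lr: "a \<le> l" "l \<le> i" "i \<le> r" "r \<le> b"
          and above: "\<And>j. j \<in> {l..r} \<Longrightarrow> - (\<theta>_star i - t) < - \<theta>_hat \<omega> j"
          and sum: "(\<Sum>j=l..r. of_bool (- y \<omega> j < - \<theta>_hat \<omega> j) - (1 - \<tau>)) \<le> lam * (end_slope l a + end_slope r b)"
        by blast
      \<comment> \<open>Noise above \<open>- t\<close> puts the observation above the estimate on the run.\<close>
      have "real (r + 1 - l) * B - (\<Sum>j=l..r. of_bool (- y \<omega> j < - \<theta>_hat \<omega> j) - (1 - \<tau>))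
          = (\<Sum>j=l..r. B - (of_bool (- y \<omega> j < - \<theta>_hat \<omega> j) - (1 - \<tau>)))"
        by (simp add: sum_subtractf)
      also have "\<dots> \<le> (\<Sum>j=l..r. Xd j \<omega>)"
      proof (rule sum_mono)
        fix j assume j: "j \<in> {l..r}"
        hence "y \<omega> j = \<theta>_star i + \<epsilon> j \<omega>" using lr by (intro y) auto
        thus "B - (of_bool (- y \<omega> j < - \<theta>_hat \<omega> j) - (1 - \<tau>)) \<le> Xd j \<omega>"
          using above[OF j] down by (auto simp: Xd_def of_bool_def)
      qed
      finally have "real (r + 1 - l) * B - lam * (end_slope l a + end_slope r b) \<le> (\<Sum>j=l..r. Xd j \<omega>)"
        using sum by linarith
      hence "\<omega> \<in> ?excursion Xd" using \<omega> lr by blast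
      thus ?thesis using D by blast
    qed
  qed
  hence "space M - ?good \<subseteq> U \<union> D" by (auto simp: t_def)
  hence "prob (space M - ?good) \<le> prob (U \<union> D)" using U D by (intro finite_measure_mono) auto
  also have "\<dots> \<le> prob U + prob D" using U D by (intro measure_Un_le) auto
  also have "\<dots> \<le> 10 * exp (- 2 * q)" using U D by simp
  also have "exp (- 2 * q) = \<delta>\<^sup>2"
  proof -
    have "exp (- 2 * q) = (exp (- q))\<^sup>2" by (simp add: power2_eq_square flip: exp_add)
    also have "exp (- q) = \<delta>" using \<delta> by (simp add: q_def ln_div)
    finally show ?thesis .
  qed
  finally have "prob (space M - ?good) \<le> 10 * \<delta>\<^sup>2" .
  moreover have "prob (space M - ?good) = 1 - prob ?good"
    by (rule prob_compl) measurable
  moreover have "10 * \<delta>\<^sup>2 \<le> 2 * (1 + 24 / (ln 2)\<^sup>2) * \<delta>\<^sup>2"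
  proof (rule mult_right_mono)
    have "(ln 2)\<^sup>2 \<le> (1 :: real)" using ln_le_minus_one[of "2 :: real"] by (simp add: power_le_one)
    hence "24 \<le> 24 / (ln 2 :: real)\<^sup>2" by (simp add: field_simps)
    thus "10 \<le> 2 * (1 + 24 / (ln 2 :: real)\<^sup>2)" by simp
  qed simp
  ultimately show ?thesis by linarith
qed

end
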